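(* For any $\epsilon>0$, there is a (deterministic) protocol for message exchange in the full termination model that is resilient to a noise rate of $\frac{1}{2+\sqrt{2}}-\epsilon$ relative to the total number of rounds.
   Context: Message exchange: Alice holds $x\in\{0,1\}^n$, Bob holds $y\in\{0,1\}^n$, and the goal is that both parties output $(x,y)$. Full termination model: the protocol proceeds in rounds; in each round a single party, fixed beforehand, sends one symbol of an alphabet $\Sigma$ (of constant size depending on $\epsilon$) to the other party. At any round a party may irreversibly terminate, giving an output; it then neither speaks nor listens. From then on, as long as the other party has not terminated, in each round where the terminated party is the designated speaker a special symbol $\emptyset$ is automatically sent. The adversary may corrupt any round (including rounds in which $\emptyset$ is sent) into any symbol. The protocol is resilient to an $\alpha$ fraction of errors if for all inputs $x,y$ and all adversarial attacks in which the last party to terminate does so at round $R$, if the number of corrupted rounds is at most $\alpha R$, then both Alice and Bob output $(x,y)$. *)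

theory Defs
  imports Complex_Main
begin

datatype party = Alice | Bob

text \<open>
  The alphabet of size \<open>q\<close> is \<open>{..<q}\<close>. What travels over the channel is either \<open>Some s\<close>
  with \<open>s < q\<close>, or \<open>None\<close>, the special symbol sent automatically in place of a party that
  has terminated.
\<close>

type_synonym channel_symbol = "nat option"

definition channel_symbols :: "nat \<Rightarrow> channel_symbol set" where
  "channel_symbols q = insert None (Some ` {..<q})"

text \<open>
  A deterministic protocol. Rounds are numbered from 0. A party acts on its input, the current
  round number \<open>t\<close> and the list of symbols it received in the rounds before \<open>t\<close> in which the other
  party was the designated speaker; what it sent itself is determined by these data.

  At the beginning of round \<open>t\<close>, that is, when exactly \<open>t\<close> rounds have taken place, a party that is
  still active consults \<open>decision\<close>: the value \<open>Some z\<close> means that it terminates with output \<open>z\<close>,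
  the value \<open>None\<close> that it goes on. If it goes on and is the designated speaker of round \<open>t\<close>, it
  sends \<open>message\<close>. The speaker of a round depends on the round number only.
\<close>

record protocol =
  speaker :: "nat \<Rightarrow> party"
  message :: "party \<Rightarrow> bool list \<Rightarrow> nat \<Rightarrow> channel_symbol list \<Rightarrow> nat"
  decision :: "party \<Rightarrow> bool list \<Rightarrow> nat \<Rightarrow> channel_symbol list \<Rightarrow> (bool list \<times> bool list) option"

text \<open>
  As the protocol is deterministic, once the inputs are fixed an adversarial attack amounts to the
  sequence \<open>r\<close> of symbols delivered by the channel, \<open>r t\<close> being what the listener of round \<open>t\<close> gets:
  whatever the adversary looks at when it chooses its corruptions, it produces such a sequence, and
  round \<open>t\<close> is corrupted iff \<open>r t\<close> differs from the symbol actually sent. A symbol of the alphabet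
  may be corrupted into \<open>None\<close> and vice versa.
\<close>

definition attack :: "nat \<Rightarrow> (nat \<Rightarrow> channel_symbol) \<Rightarrow> bool" where
  "attack q r \<longleftrightarrow> (\<forall>t. r t \<in> channel_symbols q)"

definition received :: "protocol \<Rightarrow> (nat \<Rightarrow> channel_symbol) \<Rightarrow> party \<Rightarrow> nat \<Rightarrow> channel_symbol list" where
  "received P r p t = map r (filter (\<lambda>i. speaker P i \<noteq> p) [0..<t])"

definition input_of :: "bool list \<Rightarrow> bool list \<Rightarrow> party \<Rightarrow> bool list" where
  "input_of x y p = (case p of Alice \<Rightarrow> x | Bob \<Rightarrow> y)"

definition decision_at ::
  "protocol \<Rightarrow> bool list \<Rightarrow> bool list \<Rightarrow> (nat \<Rightarrow> channel_symbol) \<Rightarrow> party \<Rightarrow> nat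
     \<Rightarrow> (bool list \<times> bool list) option" where
  "decision_at P x y r p t = decision P p (input_of x y p) t (received P r p t)"

definition terminates ::
  "protocol \<Rightarrow> bool list \<Rightarrow> bool list \<Rightarrow> (nat \<Rightarrow> channel_symbol) \<Rightarrow> party \<Rightarrow> bool" where
  "terminates P x y r p \<longleftrightarrow> (\<exists>t. decision_at P x y r p t \<noteq> None)"

text \<open>
  Termination is irreversible, so only the first value of \<open>decision\<close> other than \<open>None\<close> counts. The
  next two definitions are meaningful only if \<^term>\<open>terminates P x y r p\<close> holds.
\<close>

definition termination_round ::
  "protocol \<Rightarrow> bool list \<Rightarrow> bool list \<Rightarrow> (nat \<Rightarrow> channel_symbol) \<Rightarrow> party \<Rightarrow> nat" where
  "termination_round P x y r p = (LEAST t. decision_at P x y r p t \<noteq> None)"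

definition party_output ::
  "protocol \<Rightarrow> bool list \<Rightarrow> bool list \<Rightarrow> (nat \<Rightarrow> channel_symbol) \<Rightarrow> party \<Rightarrow> bool list \<times> bool list" where
  "party_output P x y r p = the (decision_at P x y r p (termination_round P x y r p))"

definition sent ::
  "protocol \<Rightarrow> bool list \<Rightarrow> bool list \<Rightarrow> (nat \<Rightarrow> channel_symbol) \<Rightarrow> nat \<Rightarrow> channel_symbol" where
  "sent P x y r t =
     (let p = speaker P t in
      if \<exists>s\<le>t. decision_at P x y r p s \<noteq> None then None
      else Some (message P p (input_of x y p) t (received P r p t)))"

definition total_rounds ::
  "protocol \<Rightarrow> bool list \<Rightarrow> bool list \<Rightarrow> (nat \<Rightarrow> channel_symbol) \<Rightarrow> nat" where
  "total_rounds P x y r = max (termination_round P x y r Alice) (termination_round P x y r Bob)"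

definition corrupted_rounds ::
  "protocol \<Rightarrow> bool list \<Rightarrow> bool list \<Rightarrow> (nat \<Rightarrow> channel_symbol) \<Rightarrow> nat set" where
  "corrupted_rounds P x y r = {t. t < total_rounds P x y r \<and> r t \<noteq> sent P x y r t}"

text \<open>
  Both parties are required to terminate under every attack, however many rounds it corrupts.
  Without this, a protocol that never terminates would be vacuously resilient.
\<close>

definition full_termination_protocol :: "nat \<Rightarrow> nat \<Rightarrow> protocol \<Rightarrow> bool" where
  "full_termination_protocol n q P \<longleftrightarrow>
     (\<forall>p inp t v. message P p inp t v < q) \<and>
     (\<forall>x y r p. length x = n \<longrightarrow> length y = n \<longrightarrow> attack q r \<longrightarrow> terminates P x y r p)"

definition message_exchange_resilient :: "nat \<Rightarrow> nat \<Rightarrow> real \<Rightarrow> protocol \<Rightarrow> bool" where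
  "message_exchange_resilient n q \<alpha> P \<longleftrightarrow>
     (\<forall>x y r. length x = n \<longrightarrow> length y = n \<longrightarrow> attack q r \<longrightarrow>
        real (card (corrupted_rounds P x y r)) \<le> \<alpha> * real (total_rounds P x y r) \<longrightarrow>
        (\<forall>p. party_output P x y r p = (x, y)))"

end

theory Submission imports Defs "HOL-Library.FuncSet" begin

text \<open>
  Alice encodes \<open>x\<close> in the first \<open>L\<close> rounds, and only Bob speaks afterwards. If the nearest codeword
  is at distance \<open>d \<le> L / 2\<close> from what Bob received, then at least \<open>d\<close> rounds were corrupted if Bob
  decodes correctly and about \<open>L - d\<close> if he does not. Bob sends a codeword of \<open>y\<close> until round
  \<open>min ((1 + sqrt 2) L) ((2 + sqrt 2) (L - d))\<close> and terminates: the second bound makes a decoding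
  error unaffordable for the adversary, and the round of his termination tells Alice something about
  \<open>d\<close>. Each pair \<open>(y, d)\<close> predicts what Alice hears; let \<open>c\<close> be its distance from what she heard. She
  must stop before \<open>\<alpha> t\<close> exceeds \<open>L - d + c\<close> for some pair, since Bob may be wrong in that scenario,
  and she may output \<open>y\<close> once every other \<open>y'\<close> needs more corruption than the budget allows.
  At round \<open>(1 + sqrt 2) L\<close> at most one \<open>y\<close> is affordable because \<open>(1 - 2 \<alpha>) (1 + sqrt 2) > 1\<close>; if
  she is forced to stop earlier by \<open>(y, d)\<close>, every other \<open>y'\<close> is unaffordable because
  \<open>\<alpha> (1 + sqrt 2) < (2 + sqrt 2) / 2 - 1\<close>. Both inequalities are tight at \<open>\<alpha> = 1 / (2 + sqrt 2)\<close>.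
\<close>

section \<open>Codes with large distance on every long prefix\<close>

text \<open>Overwriting \<open>f a\<close> loses nothing, since its old value is still recorded at
  \<open>b\<close>. So each agreeing function yields \<open>q\<close> functions, and no two of them
  share one.\<close>

lemma card_agreeing_functions:
  assumes "finite S" "a \<in> S" "b \<in> S" "a \<noteq> b"
  shows "card {f \<in> S \<rightarrow>\<^sub>E {..<q}. f a = f b} * q \<le> card (S \<rightarrow>\<^sub>E {..<q::nat})"
proof -
  let ?A = "{f \<in> S \<rightarrow>\<^sub>E {..<q}. f a = f b}"
  have "inj_on (\<lambda>(f, v). f(a := v)) (?A \<times> {..<q})"
  proof (rule inj_onI, clarsimp)
    fix f v g w
    assume eq: "f(a := v) = g(a := w)" and "f a = f b" "g a = g b"
    have "v = w" using fun_cong[OF eq, of a] by simp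
    moreover have "f i = g i" for i
      using fun_cong[OF eq, of i] fun_cong[OF eq, of b] assms(4) \<open>f a = f b\<close> \<open>g a = g b\<close>
      by (cases "i = a") auto
    ultimately show "f = g \<and> v = w" by auto
  qed
  moreover have "(\<lambda>(f, v). f(a := v)) ` (?A \<times> {..<q}) \<subseteq> S \<rightarrow>\<^sub>E {..<q}"
    using assms(2) by (auto simp: PiE_iff extensional_def)
  moreover have "finite (S \<rightarrow>\<^sub>E {..<q})" using assms(1) by (simp add: finite_PiE)
  ultimately have "card (?A \<times> {..<q}) \<le> card (S \<rightarrow>\<^sub>E {..<q})" by (rule card_inj_on_le)
  then show ?thesis by (simp only: card_cartesian_product card_lessThan)
qed

lemma card_periodic_prefix:
  fixes P :: "nat \<Rightarrow> bool"
  shows "card {i. i < m * N \<and> P (i mod N)} = m * card {i. i < N \<and> P i}"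
proof (induction m)
  case 0
  then show ?case by simp
next
  case (Suc m)
  let ?B = "{i. i < N \<and> P i}"
  have "{i. i < Suc m * N \<and> P (i mod N)} = {i. i < m * N \<and> P (i mod N)} \<union> (\<lambda>i. m * N + i) ` ?B"
    (is "?L = ?M \<union> ?R")
  proof (rule set_eqI)
    fix i
    show "i \<in> ?L \<longleftrightarrow> i \<in> ?M \<union> ?R"
    proof (cases "i < m * N")
      case False
      then obtain j where j: "i = m * N + j" using le_Suc_ex by (metis not_less)
      have "j < N \<Longrightarrow> i mod N = j" using j by simp
      then show ?thesis using j by auto
    qed auto
  qed
  moreover have "card (?M \<union> ?R) = card ?M + card ?R"
    by (rule card_Un_disjoint) auto
  moreover have "card ?R = card ?B" by (rule card_image) simp
  ultimately show ?case using Suc by simp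
qed

text \<open>
  The coordinates of the code run through all functions from the messages to the alphabet, again and
  again, so that every long prefix, and not just the whole word, has relative distance near \<open>1 - 1 / q\<close>.
\<close>

lemma high_distance_code:
  assumes "finite (S :: 'a set)" "q > 0"
  obtains c :: "'a \<Rightarrow> nat \<Rightarrow> nat" and N where "\<And>a i. c a i < q"
    and "\<And>a b k. a \<in> S \<Longrightarrow> b \<in> S \<Longrightarrow> a \<noteq> b \<Longrightarrow> card {i. i < k \<and> c a i = c b i} * q \<le> k + N"
proof -
  let ?F = "S \<rightarrow>\<^sub>E {..<q}"
  define N where "N = card ?F"
  have fin: "finite ?F" using assms by (simp add: finite_PiE)
  then obtain h where h: "bij_betw h {0..<N} ?F"
    unfolding N_def using ex_bij_betw_nat_finite by blast
  have "?F \<noteq> {}" using assms by (simp add: PiE_eq_empty_iff lessThan_empty_iff)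
  then have N: "N > 0" unfolding N_def using fin by (simp add: card_gt_0_iff)
  \<comment> \<open>\<open>mod q\<close> keeps the values below \<open>q\<close> also for
    \<open>a\<close> outside \<open>S\<close>, where \<open>h\<close> yields
    \<open>undefined\<close>.\<close>
  define c where "c a i = h (i mod N) a mod q" for a i
  have "card {i. i < k \<and> c a i = c b i} * q \<le> k + N"
    if ab: "a \<in> S" "b \<in> S" "a \<noteq> b" for a b k
  proof -
    let ?B = "{i. i < N \<and> h i a mod q = h i b mod q}"
    have hF: "h i \<in> ?F" if "i < N" for i using h that by (auto simp: bij_betw_def)
    have "card ?B = card (h ` ?B)"
      by (rule card_image[symmetric], rule inj_on_subset[OF bij_betw_imp_inj_on[OF h]]) auto
    also have "\<dots> \<le> card {f \<in> ?F. f a = f b}"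
      proof (rule card_mono)
      show "finite {f \<in> ?F. f a = f b}" using fin by simp
      show "h ` ?B \<subseteq> {f \<in> ?F. f a = f b}" using hF ab by (auto simp: PiE_iff)
    qed
    finally have "card ?B * q \<le> card {f \<in> ?F. f a = f b} * q" by simp
    also have "\<dots> \<le> N"
      unfolding N_def by (rule card_agreeing_functions) (use assms ab in auto)
    finally have B: "card ?B * q \<le> N" .
    \<comment> \<open>Rounding up to whole periods adds at most \<open>N\<close> positions, the
      source of the additive \<open>N\<close>.\<close>
    let ?m = "k div N + 1"
    have "k < ?m * N"
      using N by (metis Suc_eq_plus1 dividend_less_div_times mult_Suc add.commute)
    then have "card {i. i < k \<and> c a i = c b i}
        \<le> card {i. i < ?m * N \<and> h (i mod N) a mod q = h (i mod N) b mod q}"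
      by (intro card_mono) (auto simp: c_def)
    also have "\<dots> = ?m * card ?B" by (rule card_periodic_prefix)
    finally have "card {i. i < k \<and> c a i = c b i} * q \<le> ?m * card ?B * q"
      by (rule mult_right_mono) simp
    also have "\<dots> \<le> ?m * N" using B by (metis mult.assoc mult_le_mono2)
    also have "\<dots> \<le> k + N" by (simp add: add.commute)
    finally show ?thesis .
  qed
  then show thesis using assms(2) by (intro that[of c N]) (auto simp: c_def)
qed

section \<open>The protocol and its parameters\<close>

text \<open>The range \<open>k \<le> 3 * L\<close> covers all rounds up to \<open>end_round\<close>.
  As \<open>\<epsilon> * real L\<close> is at least 10, the slack \<open>\<epsilon>\<close> absorbs
  both rounding and code agreements.\<close>

locale termination_exchange =
  fixes n L q :: nat and code :: "bool list \<Rightarrow> nat \<Rightarrow> nat" and \<epsilon> :: real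
  assumes eps: "0 < \<epsilon>" "\<epsilon> \<le> 1/10"
    and L_large: "10 \<le> \<epsilon> * real L"
    and code_less: "\<And>a i. code a i < q"
    and agreement: "\<And>a b k. length a = n \<Longrightarrow> length b = n \<Longrightarrow> a \<noteq> b \<Longrightarrow> k \<le> 3 * L \<Longrightarrow>
          real (card {i. i < k \<and> code a i = code b i}) \<le> \<epsilon> * real L / 10"
begin

definition \<alpha> :: real where "\<alpha> = 1 / (2 + sqrt 2) - \<epsilon>"

definition end_round :: nat where "end_round = nat \<lfloor>(1 + sqrt 2) * real L\<rfloor>"

definition bob_end :: "nat \<Rightarrow> nat" where
  "bob_end d = min end_round (nat \<lfloor>(2 + sqrt 2) * (real L - real d)\<rfloor>)"

definition errors :: "(nat \<Rightarrow> channel_symbol) \<Rightarrow> bool list \<Rightarrow> nat" where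
  "errors r x = card {i. i < L \<and> r i \<noteq> Some (code x i)}"

definition decoded :: "(nat \<Rightarrow> channel_symbol) \<Rightarrow> bool list" where
  "decoded r = arg_min (errors r) (\<lambda>x. length x = n)"

definition doubt :: "(nat \<Rightarrow> channel_symbol) \<Rightarrow> nat" where
  "doubt r = min (errors r (decoded r)) (L div 2)"

definition bob_symbol :: "bool list \<Rightarrow> nat \<Rightarrow> nat \<Rightarrow> channel_symbol" where
  "bob_symbol y d i = (if i < bob_end d then Some (code y i) else None)"

definition cost :: "(nat \<Rightarrow> channel_symbol) \<Rightarrow> bool list \<Rightarrow> nat \<Rightarrow> nat \<Rightarrow> nat" where
  "cost r y d t = card {i. L \<le> i \<and> i < t \<and> r i \<noteq> bob_symbol y d i}"

text \<open>The factor is the reciprocal of the noise rate at \<open>\<epsilon> = 0\<close>: at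
  round \<open>t\<close> the budget at that rate reaches the least corruption, up to code
  agreements, by which Bob misdecodes with doubt \<open>d\<close> while sending
  \<open>y\<close>.\<close>

definition must_stop :: "(nat \<Rightarrow> channel_symbol) \<Rightarrow> nat \<Rightarrow> bool list \<Rightarrow> nat \<Rightarrow> bool" where
  "must_stop r t y d \<longleftrightarrow> length y = n \<and> d \<le> L div 2 \<and>
     (2 + sqrt 2) * (real L - real d + real (cost r y d t)) \<le> real t"

text \<open>Depends only on \<open>r i\<close> for \<open>L \<le> i < t\<close>, which is all that Alice knows at round \<open>t\<close>.\<close>

definition alice_stops :: "(nat \<Rightarrow> channel_symbol) \<Rightarrow> nat \<Rightarrow> bool" where
  "alice_stops r t \<longleftrightarrow> L \<le> t \<and> (end_round \<le> t \<or> (\<exists>y d. must_stop r t y d))"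

text \<open>Doubt \<open>d\<close> needs at least \<open>d\<close> errors in Alice's phase, and
  \<open>max t (bob_end d)\<close> is the total number of rounds if Alice stops at
  \<open>t\<close>.\<close>

definition plausible :: "(nat \<Rightarrow> channel_symbol) \<Rightarrow> nat \<Rightarrow> bool list \<Rightarrow> bool" where
  "plausible r t y \<longleftrightarrow> (\<exists>d \<le> L div 2. real d + real (cost r y d t) \<le> \<alpha> * real (max t (bob_end d)))"

text \<open>Asks only that the rivals be implausible, because a forced stop excludes rivals and says
  nothing for \<open>y\<close> itself. The true input is plausible within the budget, hence is the
  dominant one.\<close>

definition dominant :: "(nat \<Rightarrow> channel_symbol) \<Rightarrow> nat \<Rightarrow> bool list \<Rightarrow> bool" where
  "dominant r t y \<longleftrightarrow> length y = n \<and> (\<forall>y'. length y' = n \<longrightarrow> y' \<noteq> y \<longrightarrow> \<not> plausible r t y')"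

definition alice_output :: "(nat \<Rightarrow> channel_symbol) \<Rightarrow> nat \<Rightarrow> bool list" where
  "alice_output r t = (SOME y. dominant r t y)"

text \<open>Alice's list \<open>w\<close> begins at round \<open>L\<close> and Bob's at round 0, so
  \<open>r\<close> restores round numbers. It is inspected only where \<open>w\<close> has entries;
  Bob's guard \<open>L \<le> t\<close> waits for all of Alice's symbols.\<close>

definition exchange :: protocol where
  "exchange = \<lparr>
     speaker = (\<lambda>t. if t < L then Alice else Bob),
     message = (\<lambda>p inp t w. code inp t), \<comment> \<open>\<open>d\<close> is conveyed only by the round in which Bob terminates\<close>
     decision = (\<lambda>p inp t w. case p of
       Alice \<Rightarrow> (let r = (\<lambda>i. w ! (i - L)) in
         if alice_stops r t then Some (inp, alice_output r t) else None)
     | Bob \<Rightarrow> (let r = (\<lambda>i. w ! i) in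
         if L \<le> t \<and> bob_end (doubt r) \<le> t then Some (decoded r, inp) else None))\<rparr>"

section \<open>Numerical bounds\<close>

lemma sqrt2_bounds: "141/100 < sqrt 2" "sqrt 2 < 142/100"
  by (rule real_less_rsqrt, simp add: power2_eq_square)
     (rule real_less_lsqrt, simp_all add: power2_eq_square)

lemma sqrt2_mult: "sqrt 2 * (sqrt 2 * z) = 2 * z"
  by (simp only: mult.assoc[symmetric]) simp

lemma alpha_eq: "\<alpha> = 1 - sqrt 2 / 2 - \<epsilon>"
proof -
  have "(2 + sqrt 2) * (1 - sqrt 2 / 2) = 1" by (simp add: algebra_simps)
  moreover have "2 + sqrt 2 \<noteq> 0" using sqrt2_bounds by linarith
  ultimately show ?thesis by (simp add: \<alpha>_def field_simps)
qed

lemma alpha_pos: "\<alpha> > 0" unfolding alpha_eq using sqrt2_bounds eps by linarith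

lemma alpha_mult: "\<alpha> * (2 + sqrt 2) = 1 - \<epsilon> * (2 + sqrt 2)"
  unfolding alpha_eq by (simp add: algebra_simps)

lemma L_pos: "real L \<ge> 100"
proof -
  have "\<epsilon> * real L \<le> 1/10 * real L" using eps by (intro mult_right_mono) auto
  then show ?thesis using L_large by linarith
qed

lemma sqrt2_L: "141/100 * real L \<le> sqrt 2 * real L" "sqrt 2 * real L \<le> 142/100 * real L"
  using sqrt2_bounds by (intro mult_right_mono; simp)+

lemma end_round_bounds:
  "(1 + sqrt 2) * real L - 1 < real end_round" "real end_round \<le> (1 + sqrt 2) * real L"
proof -
  have "(1 + sqrt 2) * real L \<ge> 0" using sqrt2_bounds by simp
  then show "(1 + sqrt 2) * real L - 1 < real end_round" "real end_round \<le> (1 + sqrt 2) * real L"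
    unfolding end_round_def by linarith+
qed

lemma end_round_range: "2 * L \<le> end_round" "end_round \<le> 3 * L"
proof -
  have "(1 + sqrt 2) * real L = real L + sqrt 2 * real L" by (simp add: algebra_simps)
  then show "2 * L \<le> end_round" "end_round \<le> 3 * L"
    using end_round_bounds sqrt2_L L_pos by linarith+
qed

lemma bob_end_le: "bob_end d \<le> end_round" by (simp add: bob_end_def)

text \<open>For \<open>d\<close> up to \<open>L / 2\<close> the second bound in
  \<open>bob_end\<close> is at least \<open>(1 + sqrt 2 / 2) * L\<close>, so Bob never stops during
  Alice's phase.\<close>

lemma bob_end_cases:
  assumes "d \<le> L div 2"
  shows "bob_end d = end_round \<or> (2 + sqrt 2) * (real L - real d) - 1 < real (bob_end d)"
    and "real (bob_end d) \<le> (2 + sqrt 2) * (real L - real d)"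
    and "L \<le> bob_end d"
proof -
  have d: "real d \<le> real L / 2" using assms by linarith
  have "(2 + sqrt 2) * (real L / 2) \<le> (2 + sqrt 2) * (real L - real d)"
    using d sqrt2_bounds by (intro mult_left_mono) auto
  then have ge: "17/10 * real L \<le> (2 + sqrt 2) * (real L - real d)"
    using sqrt2_L by (simp add: algebra_simps)
  let ?z = "(2 + sqrt 2) * (real L - real d)"
  have f: "?z - 1 < real (nat \<lfloor>?z\<rfloor>)" "real (nat \<lfloor>?z\<rfloor>) \<le> ?z" using ge by linarith+
  show "bob_end d = end_round \<or> ?z - 1 < real (bob_end d)" "real (bob_end d) \<le> ?z"
    using f unfolding bob_end_def by (auto simp: min_def)
  have "real L \<le> real (nat \<lfloor>?z\<rfloor>)" using f ge L_pos by linarith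
  then show "L \<le> bob_end d" using end_round_range unfolding bob_end_def by auto
qed

section \<open>Distances between scenarios\<close>

lemma cost_mono: "t \<le> t' \<Longrightarrow> cost r y d t \<le> cost r y d t'"
  unfolding cost_def by (rule card_mono) auto

text \<open>Until the later of the two ends the scenarios predict different symbols, except at code
  agreements: once a single Bob has stopped, \<open>None\<close> differs from any
  \<open>Some\<close>. Each such round is charged to at least one of them.\<close>

lemma cost_sum:
  assumes "length y = n" "length y' = n" "y \<noteq> y'"
  shows "real (min t (max (bob_end d) (bob_end d'))) - real L - \<epsilon> * real L / 10
           \<le> real (cost r y d t) + real (cost r y' d' t)"
proof -
  let ?m = "min t (max (bob_end d) (bob_end d'))"
  let ?C = "{i. L \<le> i \<and> i < t \<and> r i \<noteq> bob_symbol y d i}"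
  let ?C' = "{i. L \<le> i \<and> i < t \<and> r i \<noteq> bob_symbol y' d' i}"
  let ?A = "{i. i < ?m \<and> code y i = code y' i}"
  have "?m \<le> 3 * L" using bob_end_le[of d] bob_end_le[of d'] end_round_range by linarith
  then have A: "real (card ?A) \<le> \<epsilon> * real L / 10" using agreement assms by blast
  have "{L..<?m} \<subseteq> ?C \<union> ?C' \<union> ?A"
    by (auto simp: bob_symbol_def split: if_splits)
  then have "card {L..<?m} \<le> card (?C \<union> ?C' \<union> ?A)" by (intro card_mono) auto
  also have "\<dots> \<le> card ?C + card ?C' + card ?A"
    by (meson card_Un_le add_le_mono1 order_trans)
  finally have "?m - L \<le> cost r y d t + cost r y' d' t + card ?A" unfolding cost_def by simp
  then show ?thesis using A by linarith
qed

lemma errors_sum: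
  assumes "length x = n" "length x' = n" "x \<noteq> x'"
  shows "real L - \<epsilon> * real L / 10 \<le> real (errors r x) + real (errors r x')"
proof -
  let ?C = "{i. i < L \<and> r i \<noteq> Some (code x i)}"
  let ?C' = "{i. i < L \<and> r i \<noteq> Some (code x' i)}"
  let ?A = "{i. i < L \<and> code x i = code x' i}"
  have A: "real (card ?A) \<le> \<epsilon> * real L / 10" using agreement[OF assms, of L] by simp
  have "{..<L} \<subseteq> ?C \<union> ?C' \<union> ?A" by auto
  then have "card {..<L} \<le> card (?C \<union> ?C' \<union> ?A)" by (intro card_mono) auto
  also have "\<dots> \<le> card ?C + card ?C' + card ?A"
    by (meson card_Un_le add_le_mono1 order_trans)
  finally have "L \<le> errors r x + errors r x' + card ?A" unfolding errors_def by simp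
  then show ?thesis using A by linarith
qed

lemma decoded:
  assumes "length x = n"
  shows "length (decoded r) = n" "errors r (decoded r) \<le> errors r x"
  unfolding decoded_def using arg_min_nat_lemma[of "\<lambda>x. length x = n" x "errors r"] assms by auto

lemma doubt_le_half: "doubt r \<le> L div 2" by (simp add: doubt_def)

lemma doubt_le_errors: "length x = n \<Longrightarrow> doubt r \<le> errors r x"
  using decoded(2)[of x r] by (simp add: doubt_def)

text \<open>
  The cap \<open>L div 2\<close> in \<^const>\<open>doubt\<close> costs nothing: above it, \<open>errors r x\<close> itself exceeds half of \<open>L\<close>.
\<close>

lemma errors_if_misdecoded:
  assumes "length x = n" "decoded r \<noteq> x"
  shows "real L - real (doubt r) - \<epsilon> * real L / 10 \<le> real (errors r x)"
proof (cases "errors r (decoded r) \<le> L div 2")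
  case True
  then show ?thesis
    using errors_sum[OF decoded(1)[OF assms(1)] assms(1) assms(2), of r] by (simp add: doubt_def)
next
  case False
  \<comment> \<open>For odd \<open>L\<close> this uses that the errors are at least
    \<open>L div 2 + 1\<close>.\<close>
  then have "L - doubt r \<le> errors r x" using decoded(2)[OF assms(1), of r] by (simp add: doubt_def)
  then have "real L - real (doubt r) \<le> real (errors r x)" by linarith
  moreover have "0 \<le> \<epsilon> * real L" using eps by simp
  ultimately show ?thesis by linarith
qed

section \<open>Uniqueness of Bob's input when Alice stops\<close>

lemma plausible_unique_at_end:
  assumes "length y = n" "length y' = n" "y \<noteq> y'"
    and "plausible r end_round y" "plausible r end_round y'"
  shows False
proof -
  have max: "max end_round (bob_end d) = end_round" for d using bob_end_le by (simp add: max_absorb1)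
  obtain d where d: "d \<le> L div 2" "real d + real (cost r y d end_round) \<le> \<alpha> * real end_round"
    using assms(4) unfolding plausible_def max by blast
  obtain d' where d': "d' \<le> L div 2" "real d' + real (cost r y' d' end_round) \<le> \<alpha> * real end_round"
    using assms(5) unfolding plausible_def max by blast
  let ?T = "real (max (bob_end d) (bob_end d'))"
  have sum: "?T - real L - \<epsilon> * real L / 10 + real d + real d' \<le> 2 * \<alpha> * real end_round"
    using cost_sum[OF assms(1-3), of end_round d d' r] d d' bob_end_le[of d] bob_end_le[of d']
    by (simp add: min_absorb2)
  have dd: "real d \<le> real L / 2" "real d' \<le> real L / 2" using d d' by linarith+
  have eT: "2 * \<epsilon> * real end_round \<ge> 4 * (\<epsilon> * real L)"
    using end_round_range(1) eps mult_left_mono[of "2 * real L" "real end_round" "2 * \<epsilon>"] by simp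
  \<comment> \<open>At \<open>\<epsilon> = 0\<close> the factor is \<open>1 - 2 * \<alpha>\<close>,
    and \<open>(sqrt 2 - 1) * (1 + sqrt 2) = 1\<close>: this case is tight.\<close>
  have "(sqrt 2 - 1) * ((1 + sqrt 2) * real L - 1) \<le> (sqrt 2 - 1) * real end_round"
    using end_round_bounds sqrt2_bounds by (intro mult_left_mono) auto
  then have a: "real L + 1 - sqrt 2 + 4 * (\<epsilon> * real L) + 2 * \<alpha> * real end_round \<le> real end_round"
    using eT unfolding alpha_eq by (simp add: algebra_simps)
  have b: "2 * \<alpha> * real end_round \<le> sqrt 2 * real L"
  proof -
    have "2 * \<alpha> * real end_round \<le> (2 - sqrt 2) * real end_round"
      unfolding alpha_eq using eps by (intro mult_right_mono) auto
    also have "\<dots> \<le> (2 - sqrt 2) * ((1 + sqrt 2) * real L)"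
      using end_round_bounds sqrt2_bounds by (intro mult_left_mono) auto
    also have "\<dots> = sqrt 2 * real L" by (simp add: algebra_simps)
    finally show ?thesis .
  qed
  have eL: "\<epsilon> * real L \<le> real L / 10" using eps mult_right_mono[of \<epsilon> "1/10" "real L"] by simp
  show False
  proof (cases "bob_end d = end_round \<or> bob_end d' = end_round")
    case True
    then have "?T \<ge> real end_round" by auto
    then show False using sum a L_large sqrt2_bounds by linarith
  next
    case False
    then have T: "(2 + sqrt 2) * (real L - real d) - 1 < ?T" "(2 + sqrt 2) * (real L - real d') - 1 < ?T"
      using bob_end_cases(1)[OF d(1)] bob_end_cases(1)[OF d'(1)] by auto
    \<comment> \<open>Averaging the two bounds makes the estimate depend on \<open>d + d'\<close>
      only.\<close>
    have "(1 + sqrt 2 / 2) * (2 * real L - real d - real d') - 1 < ?T"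
    proof -
      have "2 * ((1 + sqrt 2 / 2) * (2 * real L - real d - real d'))
          = (2 + sqrt 2) * (real L - real d) + (2 + sqrt 2) * (real L - real d')"
        by (simp add: field_simps)
      then show ?thesis using T by linarith
    qed
    moreover have "(sqrt 2 / 2) * (real L) \<le> (sqrt 2 / 2) * (2 * real L - real d - real d')"
      using dd by (intro mult_left_mono) auto
    ultimately have "2 * real L - real d - real d' + sqrt 2 * real L / 2 - 1 < ?T"
      by (simp add: algebra_simps)
    then show False using sum b eL sqrt2_L L_pos by linarith
  qed
qed

text \<open>The forced stop bounds the cost of \<open>(y, d)\<close> from above, so by
  \<open>cost_sum\<close> a rival is expensive. If the rival's Bob has already stopped there is room
  to spare; otherwise its budget grows to \<open>\<alpha> * real (bob_end d')\<close>, and the bound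
  is tight.\<close>

lemma implausible_if_must_stop:
  assumes "must_stop r t y d" "t \<le> end_round" "length y' = n" "y' \<noteq> y"
  shows "\<not> plausible r t y'"
proof
  assume "plausible r t y'"
  then obtain d' where d': "d' \<le> L div 2"
      "real d' + real (cost r y' d' t) \<le> \<alpha> * real (max t (bob_end d'))"
    unfolding plausible_def by blast
  have y: "length y = n" and d: "d \<le> L div 2"
    and ms: "(2 + sqrt 2) * (real L - real d + real (cost r y d t)) \<le> real t"
    using assms(1) unfolding must_stop_def by auto
  have dd: "real d \<le> real L / 2" "real d' \<le> real L / 2" using d d' by linarith+
  have eL: "\<epsilon> * real L \<le> real L / 10" using eps mult_right_mono[of \<epsilon> "1/10" "real L"] by simp
  have c: "real L - real d + real (cost r y d t) \<le> (1 - sqrt 2 / 2) * real t"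
  proof -
    have "(1 - sqrt 2 / 2) * ((2 + sqrt 2) * (real L - real d + real (cost r y d t)))
        \<le> (1 - sqrt 2 / 2) * real t"
      using ms sqrt2_bounds by (intro mult_left_mono) auto
    then show ?thesis by (simp add: algebra_simps sqrt2_mult)
  qed
  have t: "(2 + sqrt 2) * (real L - real d) \<le> real t"
    using mult_left_mono[of "real L - real d" "real L - real d + real (cost r y d t)" "2 + sqrt 2"]
      ms sqrt2_bounds by linarith
  then have td: "bob_end d \<le> t" using bob_end_cases(2)[OF d] by linarith
  have sum: "real (min t (max (bob_end d) (bob_end d'))) - real L - \<epsilon> * real L / 10
           \<le> real (cost r y d t) + real (cost r y' d' t)"
    by (rule cost_sum) (use y assms in auto)
  have b: "(1 - sqrt 2 / 2) * real end_round \<le> sqrt 2 * real L / 2"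
  proof -
    have "(1 - sqrt 2 / 2) * real end_round \<le> (1 - sqrt 2 / 2) * ((1 + sqrt 2) * real L)"
      using end_round_bounds sqrt2_bounds by (intro mult_left_mono) auto
    also have "\<dots> = sqrt 2 * real L / 2" by (simp add: algebra_simps)
    finally show ?thesis .
  qed
  show False
  proof (cases "bob_end d' \<le> t")
    case True
    have bt: "(1 - sqrt 2 / 2) * real t \<le> sqrt 2 * real L / 2"
      by (rule order_trans[OF mult_left_mono b]) (use assms(2) sqrt2_bounds in auto)
    have "\<alpha> * real t \<le> (1 - sqrt 2 / 2) * real t"
      unfolding alpha_eq using eps by (intro mult_right_mono) auto
    moreover have "real (min t (max (bob_end d) (bob_end d'))) \<ge> real (bob_end d')"
      using True td by auto
    moreover have "max t (bob_end d') = t" using True by simp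
    ultimately have "real (bob_end d') + real d' - real d - \<epsilon> * real L / 10 \<le> sqrt 2 * real L"
      using sum c d'(2) bt by simp
    \<comment> \<open>The worst case is \<open>d' = L / 2\<close> with the second bound in
      \<open>bob_end\<close>, giving \<open>(3 + sqrt 2) / 2 * L\<close>, up to rounding.\<close>
    moreover have "real (bob_end d') + real d' \<ge> 22/10 * real L - 1"
    proof -
      have "(1 + sqrt 2) * real d' \<le> (1 + sqrt 2) * (real L / 2)"
        using dd sqrt2_bounds by (intro mult_left_mono) auto
      then show ?thesis
        using bob_end_cases(1)[OF d'(1)] end_round_bounds(1) sqrt2_L by (auto simp: algebra_simps)
    qed
    ultimately show False using dd eL sqrt2_L L_pos by linarith
  next
    case False
    have "\<alpha> * real (bob_end d') \<le> \<alpha> * real end_round"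
      using alpha_pos bob_end_le by (intro mult_left_mono) auto
    also have "\<dots> = (1 - sqrt 2 / 2) * real end_round - \<epsilon> * real end_round"
      unfolding alpha_eq by (simp add: algebra_simps)
    also have "\<dots> \<le> sqrt 2 * real L / 2 - 2 * (\<epsilon> * real L)"
    proof -
      have "\<epsilon> * (2 * real L) \<le> \<epsilon> * real end_round"
        using end_round_range(1) eps by (intro mult_left_mono) auto
      then show ?thesis using b by linarith
    qed
    finally have a: "\<alpha> * real (bob_end d') \<le> sqrt 2 * real L / 2 - 2 * (\<epsilon> * real L)" .
    have "real (min t (max (bob_end d) (bob_end d'))) = real t"
      "max t (bob_end d') = bob_end d'" using False td by auto
    then have m: "sqrt 2 / 2 * real t - real d - \<epsilon> * real L / 10 \<le> sqrt 2 * real L / 2 - 2 * (\<epsilon> * real L)"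
      using sum c d'(2) a by (simp add: algebra_simps)
    have "sqrt 2 / 2 * ((2 + sqrt 2) * (real L - real d)) \<le> sqrt 2 / 2 * real t"
      using t by (intro mult_left_mono) auto
    then have "sqrt 2 * (real L - real d) + real L - real d \<le> sqrt 2 / 2 * real t"
      by (simp add: algebra_simps)
    \<comment> \<open>The extremal case is \<open>d = L / 2\<close>; only the
      \<open>\<epsilon>\<close> terms then give the contradiction.\<close>
    moreover have "sqrt 2 * (real L / 2) \<le> sqrt 2 * (real L - real d)"
      using dd by (intro mult_left_mono) auto
    ultimately show False using m dd L_large by simp
  qed
qed

section \<open>Execution of the protocol\<close>

lemma speaker_exchange [simp]: "speaker exchange t = (if t < L then Alice else Bob)"
  by (simp add: exchange_def)

lemma received_Alice: "received exchange r Alice t = map r [L..<t]"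
proof -
  have "filter (\<lambda>i. speaker exchange i \<noteq> Alice) [0..<t] = [L..<t]"
    by (induction t) auto
  then show ?thesis by (simp only: received_def)
qed

lemma received_Bob: "received exchange r Bob t = map r [0..<min t L]"
proof -
  have "filter (\<lambda>i. speaker exchange i \<noteq> Bob) [0..<t] = [0..<min t L]"
    by (induction t) (auto simp: min_def not_le less_Suc_eq_le dest: le_antisym)
  then show ?thesis by (simp only: received_def)
qed

lemma cost_cong: "(\<And>i. L \<le> i \<Longrightarrow> i < t \<Longrightarrow> r i = r' i) \<Longrightarrow> cost r y d t = cost r' y d t"
  unfolding cost_def by (rule arg_cong[where f = card]) auto

lemma errors_cong: "(\<And>i. i < L \<Longrightarrow> r i = r' i) \<Longrightarrow> errors r = errors r'"
  unfolding errors_def by (intro ext arg_cong[where f = card]) auto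

lemma decision_at_Alice:
  "decision_at exchange x y r Alice t =
     (if alice_stops r t then Some (x, alice_output r t) else None)"
proof -
  let ?r = "\<lambda>i. map r [L..<t] ! (i - L)"
  have "cost ?r y d t = cost r y d t" for y d by (rule cost_cong) auto
  then have "alice_stops ?r t = alice_stops r t" "alice_output ?r t = alice_output r t"
    by (simp_all add: alice_stops_def must_stop_def alice_output_def dominant_def plausible_def)
  then show ?thesis
    by (simp add: decision_at_def input_of_def received_Alice) (simp add: exchange_def Let_def)
qed

lemma decision_at_Bob:
  "decision_at exchange x y r Bob t =
     (if bob_end (doubt r) \<le> t then Some (decoded r, y) else None)"
proof (cases "L \<le> t")
  case True
  let ?r = "\<lambda>i. map r [0..<L] ! i"
  have "errors ?r = errors r" by (rule errors_cong) auto
  then have "decoded ?r = decoded r" "doubt ?r = doubt r" by (simp_all add: decoded_def doubt_def)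
  then show ?thesis using True
    by (simp add: decision_at_def input_of_def received_Bob) (simp add: exchange_def Let_def)
next
  case False
  then show ?thesis using bob_end_cases(3)[OF doubt_le_half[of r]]
    by (simp add: decision_at_def exchange_def Let_def)
qed

lemma termination_round_Bob: "termination_round exchange x y r Bob = bob_end (doubt r)"
  unfolding termination_round_def decision_at_Bob by (rule Least_equality) (auto split: if_splits)

lemma alice_stops_end: "alice_stops r end_round"
  using end_round_range by (simp add: alice_stops_def)

lemma terminates_exchange: "terminates exchange x y r p"
  by (cases p)
    (auto simp: terminates_def decision_at_Alice decision_at_Bob
      intro: exI[of _ end_round] alice_stops_end)

lemma termination_round_Alice:
  fixes x y r
  defines "t \<equiv> termination_round exchange x y r Alice"
  shows "alice_stops r t" "t \<le> end_round" "\<And>s. s < t \<Longrightarrow> \<not> alice_stops r s" "L \<le> t"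
proof -
  have t: "t = (LEAST t. alice_stops r t)"
    unfolding t_def termination_round_def decision_at_Alice by (simp add: if_distrib cong: if_cong)
  show "alice_stops r t" unfolding t by (rule LeastI[of "alice_stops r", OF alice_stops_end])
  then show "L \<le> t" by (simp add: alice_stops_def)
  show "t \<le> end_round" unfolding t by (rule Least_le[of "alice_stops r", OF alice_stops_end])
  show "\<not> alice_stops r s" if "s < t" for s using that unfolding t by (rule not_less_Least)
qed

lemma sent_Alice: "i < L \<Longrightarrow> sent exchange x y r i = Some (code x i)"
  by (auto simp: sent_def decision_at_Alice alice_stops_def input_of_def)
    (simp add: exchange_def)

text \<open>Identifies \<open>(y, doubt r)\<close> as the scenario that really takes place, so that
  its \<open>cost\<close> counts genuine corruptions.\<close>

lemma sent_Bob: "L \<le> i \<Longrightarrow> sent exchange x y r i = bob_symbol y (doubt r) i"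
  by (auto simp: sent_def decision_at_Bob bob_symbol_def input_of_def)
    (simp add: exchange_def)

text \<open>Corruptions after Alice's stop may also count, hence only an inequality.\<close>

lemma corrupted_lower_bound:
  "errors r x + cost r y (doubt r) (termination_round exchange x y r Alice)
     \<le> card (corrupted_rounds exchange x y r)"
proof -
  let ?t = "termination_round exchange x y r Alice"
  let ?E = "{i. i < L \<and> r i \<noteq> Some (code x i)}"
  let ?C = "{i. L \<le> i \<and> i < ?t \<and> r i \<noteq> bob_symbol y (doubt r) i}"
  have "?E \<union> ?C \<subseteq> corrupted_rounds exchange x y r"
    using termination_round_Alice(4)[where x = x and y = y and r = r]
    by (auto simp: corrupted_rounds_def total_rounds_def sent_Alice sent_Bob)
  moreover have "finite (corrupted_rounds exchange x y r)" by (simp add: corrupted_rounds_def)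
  ultimately have "card (?E \<union> ?C) \<le> card (corrupted_rounds exchange x y r)" by (intro card_mono)
  moreover have "card (?E \<union> ?C) = card ?E + card ?C" by (rule card_Un_disjoint) auto
  ultimately show ?thesis by (simp add: errors_def cost_def)
qed

section \<open>Correctness of both outputs\<close>

lemma exchange_correct:
  assumes "length x = n" "length y = n"
    and noise: "real (card (corrupted_rounds exchange x y r)) \<le> \<alpha> * real (total_rounds exchange x y r)"
  shows "party_output exchange x y r p = (x, y)"
proof -
  define t where "t = termination_round exchange x y r Alice"
  define d where "d = doubt r"
  note t = termination_round_Alice[where x = x and y = y and r = r, folded t_def]
  have d: "d \<le> L div 2" "d \<le> errors r x"
    unfolding d_def using doubt_le_half doubt_le_errors assms by auto
  have noise': "real (errors r x) + real (cost r y d t) \<le> \<alpha> * real (max t (bob_end d))"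
  proof -
    have "real (errors r x + cost r y d t) \<le> real (card (corrupted_rounds exchange x y r))"
      unfolding t_def d_def by (simp only: of_nat_le_iff corrupted_lower_bound)
    also note noise
    finally show ?thesis by (simp add: total_rounds_def termination_round_Bob t_def d_def)
  qed
  have "decoded r = x"
  proof (rule ccontr)
    assume "decoded r \<noteq> x"
    then have e: "real L - real d - \<epsilon> * real L / 10 + real (cost r y d t) \<le> \<alpha> * real (max t (bob_end d))"
      using errors_if_misdecoded[OF assms(1), of r] noise' unfolding d_def by linarith
    have dd: "real d \<le> real L / 2" using d by linarith
    have eL: "\<epsilon> * real L \<le> real L / 10" using eps mult_right_mono[of \<epsilon> "1/10" "real L"] by simp
    have "\<alpha> * real (bob_end d) < real L - real d - \<epsilon> * real L / 10"
    proof -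
      have "\<alpha> * real (bob_end d) \<le> \<alpha> * ((2 + sqrt 2) * (real L - real d))"
        using bob_end_cases(2)[OF d(1)] alpha_pos by (intro mult_left_mono) auto
      also have "\<dots> = (1 - \<epsilon> * (2 + sqrt 2)) * (real L - real d)"
        by (simp only: mult.assoc[symmetric] alpha_mult)
      also have "\<dots> \<le> (1 - \<epsilon> * 2) * (real L - real d)"
        using eps dd by (intro mult_right_mono diff_left_mono mult_left_mono) auto
      finally have "\<alpha> * real (bob_end d) \<le> real L - real d - 2 * (\<epsilon> * (real L - real d))"
        by (simp add: algebra_simps)
      moreover have "\<epsilon> * (real L / 2) \<le> \<epsilon> * (real L - real d)"
        using eps dd by (intro mult_left_mono) auto
      ultimately show ?thesis using L_large by simp
    qed
    moreover have "\<alpha> * real t < real L - real d - \<epsilon> * real L / 10 + real (cost r y d t)"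
    \<comment> \<open>A stop at \<open>L\<close> has no earlier round from which a failed stopping
      test could be used.\<close>
    proof (cases "t = L")
      case True
      have "\<alpha> * real L \<le> 3/10 * real L"
        unfolding alpha_eq using eps sqrt2_bounds by (intro mult_right_mono) auto
      then show ?thesis unfolding True using dd eL L_pos by linarith
    next
      case False
      \<comment> \<open>At the round before, the true scenario did not yet force a stop; the slack
        \<open>\<epsilon> * real t\<close> pays for the one extra round.\<close>
      then obtain s where s: "t = Suc s" "L \<le> s" using t(4) by (cases t) auto
      then have "\<not> must_stop r s y d" using t(3)[of s] by (auto simp: alice_stops_def)
      then have ns: "real s < (2 + sqrt 2) * (real L - real d + real (cost r y d s))"
        using assms d by (simp add: must_stop_def)
      let ?\<beta> = "1 - sqrt 2 / 2"
      have "?\<beta> * real s \<le> ?\<beta> * ((2 + sqrt 2) * (real L - real d + real (cost r y d s)))"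
        using ns sqrt2_bounds by (intro mult_left_mono) auto
      also have "\<dots> = real L - real d + real (cost r y d s)"
        by (simp add: algebra_simps sqrt2_mult)
      also have "\<dots> \<le> real L - real d + real (cost r y d t)"
        using cost_mono[of s t r y d] s by simp
      finally have "?\<beta> * real s \<le> real L - real d + real (cost r y d t)" .
      moreover have "\<alpha> * real t = ?\<beta> * real s + ?\<beta> - \<epsilon> * real t"
        unfolding alpha_eq s by (simp add: algebra_simps)
      moreover have "\<epsilon> * real L \<le> \<epsilon> * real t" using eps t(4) by (intro mult_left_mono) auto
      ultimately show ?thesis using L_large sqrt2_bounds by linarith
    qed
    ultimately show False using e by (auto simp: max_def split: if_splits)
  qed
  have plausible: "plausible r t y"
    unfolding plausible_def using noise' d by (intro exI[of _ d]) auto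
  have "\<exists>z. dominant r t z"
  proof (cases "\<exists>z d. must_stop r t z d")
    case True
    then obtain z d' where "must_stop r t z d'" by blast
    then have "dominant r t z"
      using implausible_if_must_stop t(2) by (auto simp: dominant_def must_stop_def)
    then show ?thesis ..
  next
    case False
    then have "t = end_round" using t(1,2) by (auto simp: alice_stops_def)
    then have "dominant r t y"
      using plausible plausible_unique_at_end assms by (auto simp: dominant_def)
    then show ?thesis ..
  qed
  then have "dominant r t (alice_output r t)" unfolding alice_output_def by (rule someI_ex)
  then have "alice_output r t = y" using plausible assms by (auto simp: dominant_def)
  then show ?thesis using \<open>decoded r = x\<close> t(1)
    by (cases p) (simp_all add: party_output_def decision_at_Alice decision_at_Bob
        t_def[symmetric] termination_round_Bob)
qed

lemma exchange_full_termination: "full_termination_protocol n q exchange"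
  unfolding full_termination_protocol_def
  using terminates_exchange code_less by (auto simp: exchange_def)

end

section \<open>Choice of alphabet and block length\<close>

theorem theorem1p2:
  fixes \<epsilon> :: real
  assumes "\<epsilon> > 0"
  shows "\<exists>q. \<forall>n. \<exists>P. full_termination_protocol n q P \<and>
           message_exchange_resilient n q (1 / (2 + sqrt 2) - \<epsilon>) P"
proof -
  define e where "e = min \<epsilon> (1/10)"
  have e: "0 < e" "e \<le> 1/10" "e \<le> \<epsilon>" using assms by (auto simp: e_def)
  \<comment> \<open>Agreements number at most \<open>4 * L / q\<close>, hence at most
    \<open>e * L / 10\<close>. The choice depends on \<open>\<epsilon>\<close> only, not on
    \<open>n\<close>.\<close>
  define q where "q = nat \<lceil>40 / e\<rceil>"
  have q: "40 / e \<le> real q" unfolding q_def by linarith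
  then have q': "40 \<le> e * real q" using e by (simp add: field_simps)
  then have q_pos: "q > 0" by (cases q) auto
  have "\<exists>P. full_termination_protocol n q P \<and>
          message_exchange_resilient n q (1 / (2 + sqrt 2) - \<epsilon>) P" for n
  proof -
    let ?S = "{a :: bool list. length a = n}"
    have "finite ?S" using finite_lists_length_eq[of "UNIV :: bool set" n] by simp
    then obtain c :: "bool list \<Rightarrow> nat \<Rightarrow> nat" and N where c: "\<And>a i. c a i < q"
      "\<And>a b k. a \<in> ?S \<Longrightarrow> b \<in> ?S \<Longrightarrow> a \<noteq> b \<Longrightarrow> card {i. i < k \<and> c a i = c b i} * q \<le> k + N"
      using high_distance_code[of ?S q] q_pos by blast
    \<comment> \<open>\<open>N \<le> L\<close> turns the additive term of the code into one more
      \<open>L\<close>.\<close>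
    define L where "L = max N (nat \<lceil>10 / e\<rceil>)"
    have "10 / e \<le> real L" unfolding L_def by linarith
    then have L: "10 \<le> e * real L" using e by (simp add: field_simps)
    interpret termination_exchange n L q c e
    proof
      fix a b :: "bool list" and k
      assume ab: "length a = n" "length b = n" "a \<noteq> b" and k: "k \<le> 3 * L"
      let ?A = "card {i. i < k \<and> c a i = c b i}"
      have "?A * q \<le> k + N" using c(2) ab by simp
      also have "\<dots> \<le> 4 * L" using k by (simp add: L_def)
      finally have "real (?A * q) \<le> real (4 * L)" by (simp only: of_nat_le_iff)
      then have "e * (real ?A * real q) \<le> e * (4 * real L)"
        using e by (intro mult_left_mono) auto
      moreover have "real ?A * 40 \<le> real ?A * (e * real q)" using q' by (intro mult_left_mono) auto
      ultimately show "real ?A \<le> e * real L / 10" by (simp add: algebra_simps)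
    qed (use e L c in auto)
    have "message_exchange_resilient n q (1 / (2 + sqrt 2) - \<epsilon>) exchange"
      unfolding message_exchange_resilient_def
    proof (intro allI impI)
      fix x y r p
      assume xy: "length x = n" "length y = n"
        and le: "real (card (corrupted_rounds exchange x y r))
          \<le> (1 / (2 + sqrt 2) - \<epsilon>) * real (total_rounds exchange x y r)"
      note le
      also have "\<dots> \<le> \<alpha> * real (total_rounds exchange x y r)"
        unfolding \<alpha>_def using e by (intro mult_right_mono) auto
      finally show "party_output exchange x y r p = (x, y)" by (rule exchange_correct[OF xy])
    qed
    then show ?thesis using exchange_full_termination by blast
  qed
  then show ?thesis by blast
qed

end
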